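(* Let $l$ be an integer, $m_0=2l+1$ ($l\ge 0$) for type A, and $m=2l$ ($l\geq 1$) for types C and D. Then, with $\Sigma^A_{m_0,2n}$, $\Sigma^C_{m,2n}$, $\Sigma^D_{m,2n}$ the sets of signed-residue Young diagrams defined in the context, $$\sum_{n\ge0}|\Sigma_{m_0,2n}^A|x^n=\prod_{k\ge1}\frac{1}{(1-x^k)^{l+1}},\qquad \sum_{n\ge0}|\Sigma_{m,2n}^C|x^n=\prod_{k\ge1}\frac{1+x^k}{(1-x^k)^l},$$ $$\sum_{n\ge0}|\Sigma_{m,2n}^D|x^n=\prod_{k\ge1}\frac{1}{(1-x^k)^{l+1}(1+x^k)}.$$
   Context: Fix a sign $\pm$. For a positive integer $k$, a Young $(k,+)$-diagram (resp. $(k,-)$-diagram) is a Young diagram whose rows are filled with consecutive decreasing (resp. increasing) numbers from $\{1,\dots,k\}$, read cyclically ($k$ identified with $0$); diagrams are identified if they differ by interchanging rows. Write $$\lambda=(\lambda_1)_1^{p_1^1}\cdots(\lambda_1)_k^{p_1^k}\cdots(\lambda_s)_1^{p_s^1}\cdots(\lambda_s)_k^{p_s^k},\quad \lambda_1>\cdots>\lambda_s>0,\ \textstyle\sum_jp_i^j>0,$$ for the diagram with $p_i^j$ rows of length $\lambda_i$ whose beginning box is filled with $j$. Its number of boxes is $|\lambda|=\sum_i\sum_jp_i^j\lambda_i$. Superscripts $a,b$ below run over $\{1,\dots,k\}$. $\Sigma^A_{m_0,2n}$: the set of Young $(m_0,\pm)$-diagrams with $2n$ boxes such that for every $i$: $p_i^a=p_i^b$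 if $a+b\equiv\lambda_i \pmod{m_0}$, and $p_i^a$ is even if $2a\equiv\lambda_i\pmod{m_0}$. $\Sigma^C_{m,2n}$: the set of Young $(m,\pm)$-diagrams with $2n$ boxes such that for every $i$: $p_i^a=p_i^b$ if $a+b\equiv\lambda_i-1\pmod m$, and $p_i^a$ is even if $2a\equiv\lambda_i-1\pmod m$. $\Sigma^D_{m,2n}$: the set of Young $(m,\pm)$-diagrams with $2n$ boxes such that for every $i$: $p_i^a=p_i^b$ if $a+b\equiv\lambda_i\pmod m$, and $p_i^a$ is even if $2a\equiv\lambda_i\pmod m$. The empty diagram is counted for $n=0$. *)

theory Defs
  imports
    "HOL-Analysis.Analysis"
    "HOL-Computational_Algebra.Formal_Power_Series"
    "HOL-Library.Multiset"
    "HOL-Number_Theory.Cong"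
begin

datatype dsign = Sign_plus | Sign_minus

text \<open>
  Two adjacent boxes of a row, read from the beginning box: the residue goes down by one
  in the plus case and up by one in the minus case, read cyclically modulo \<open>k\<close>.
\<close>

fun residue_step :: "dsign \<Rightarrow> nat \<Rightarrow> nat \<Rightarrow> nat \<Rightarrow> bool" where
  "residue_step Sign_plus k x y \<longleftrightarrow> [x = y + 1] (mod k)"
| "residue_step Sign_minus k x y \<longleftrightarrow> [y = x + 1] (mod k)"

definition diagram_row :: "dsign \<Rightarrow> nat \<Rightarrow> nat list \<Rightarrow> bool" where
  "diagram_row s k r \<longleftrightarrow> r \<noteq> [] \<and> set r \<subseteq> {1..k} \<and> successively (residue_step s k) r"

text \<open>
  A filled diagram is the multiset of its rows: this is the identification of diagrams that
  differ by interchanging rows, and listing the rows by decreasing length recovers the shape.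
\<close>

definition young_diagram :: "dsign \<Rightarrow> nat \<Rightarrow> nat list multiset \<Rightarrow> bool" where
  "young_diagram s k Y \<longleftrightarrow> (\<forall>r\<in>#Y. diagram_row s k r)"

definition boxes :: "nat list multiset \<Rightarrow> nat" where
  "boxes Y = (\<Sum>r\<in>#Y. length r)"

definition row_lengths :: "nat list multiset \<Rightarrow> nat set" where
  "row_lengths Y = length ` set_mset Y"

text \<open>\<open>row_mult Y \<mu> j\<close> is the exponent \<open>p\<^sub>i\<^sup>j\<close> for the row length \<open>\<mu> = \<lambda>\<^sub>i\<close>.\<close>

definition row_mult :: "nat list multiset \<Rightarrow> nat \<Rightarrow> nat \<Rightarrow> nat" where
  "row_mult Y \<mu> j = size {#r \<in># Y. length r = \<mu> \<and> hd r = j#}"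

definition Sigma_A :: "dsign \<Rightarrow> nat \<Rightarrow> nat \<Rightarrow> nat list multiset set" where
  "Sigma_A s m N = {Y. young_diagram s m Y \<and> boxes Y = N \<and>
     (\<forall>\<mu>\<in>row_lengths Y.
        (\<forall>a\<in>{1..m}. \<forall>b\<in>{1..m}. [a + b = \<mu>] (mod m) \<longrightarrow> row_mult Y \<mu> a = row_mult Y \<mu> b) \<and>
        (\<forall>a\<in>{1..m}. [2 * a = \<mu>] (mod m) \<longrightarrow> even (row_mult Y \<mu> a)))}"

text \<open>Rows are nonempty, so the subtraction \<open>\<mu> - 1\<close> below never truncates.\<close>

definition Sigma_C :: "dsign \<Rightarrow> nat \<Rightarrow> nat \<Rightarrow> nat list multiset set" where
  "Sigma_C s m N = {Y. young_diagram s m Y \<and> boxes Y = N \<and>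
     (\<forall>\<mu>\<in>row_lengths Y.
        (\<forall>a\<in>{1..m}. \<forall>b\<in>{1..m}. [a + b = \<mu> - 1] (mod m) \<longrightarrow> row_mult Y \<mu> a = row_mult Y \<mu> b) \<and>
        (\<forall>a\<in>{1..m}. [2 * a = \<mu> - 1] (mod m) \<longrightarrow> even (row_mult Y \<mu> a)))}"

definition Sigma_D :: "dsign \<Rightarrow> nat \<Rightarrow> nat \<Rightarrow> nat list multiset set" where
  "Sigma_D s m N = {Y. young_diagram s m Y \<and> boxes Y = N \<and>
     (\<forall>\<mu>\<in>row_lengths Y.
        (\<forall>a\<in>{1..m}. \<forall>b\<in>{1..m}. [a + b = \<mu>] (mod m) \<longrightarrow> row_mult Y \<mu> a = row_mult Y \<mu> b) \<and>
        (\<forall>a\<in>{1..m}. [2 * a = \<mu>] (mod m) \<longrightarrow> even (row_mult Y \<mu> a)))}"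

text \<open>
  The sets are finite, so \<^const>\<open>card\<close> is a genuine count for them.
\<close>

lemma finite_young_diagrams: "finite {Y. young_diagram s k Y \<and> boxes Y = N}"
proof -
  let ?R = "{r. set r \<subseteq> {1..k} \<and> length r \<le> N}"
  have fin: "finite ?R"
    by (rule finite_lists_length_le) simp
  have "{Y. young_diagram s k Y \<and> boxes Y = N} \<subseteq> (\<Union>i\<le>N. {Y. set_mset Y \<subseteq> ?R \<and> size Y = i})"
  proof
    fix Y assume "Y \<in> {Y. young_diagram s k Y \<and> boxes Y = N}"
    hence rows: "\<forall>r\<in>#Y. r \<noteq> [] \<and> set r \<subseteq> {1..k}" and N: "(\<Sum>r\<in>#Y. length r) = N"
      by (auto simp: young_diagram_def diagram_row_def boxes_def)
    have len: "length r \<le> N" if "r \<in># Y" for r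
      using that N by (auto dest!: multi_member_split)
    have "(\<forall>r\<in>#Y. r \<noteq> []) \<Longrightarrow> size Y \<le> (\<Sum>r\<in>#Y. length r)"
    proof (induction Y)
      case (add r Y)
      then have "1 \<le> length r" by (cases r) auto
      with add show ?case by simp
    qed simp
    with rows N len show "Y \<in> (\<Union>i\<le>N. {Y. set_mset Y \<subseteq> ?R \<and> size Y = i})"
      by auto
  qed
  moreover have "finite (\<Union>i\<le>N. {Y. set_mset Y \<subseteq> ?R \<and> size Y = i})"
    using finite_multisets_of_size[OF fin] unfolding multisets_of_size_def by blast
  ultimately show ?thesis
    by (rule finite_subset)
qed

lemma finite_Sigma: "finite (Sigma_A s m N)" "finite (Sigma_C s m N)" "finite (Sigma_D s m N)"
  by (rule finite_subset[OF _ finite_young_diagrams[of s m N]];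
      auto simp: Sigma_A_def Sigma_C_def Sigma_D_def)+

end

theory Submission
  imports Defs
begin

text \<open>
  A row is determined by its length \<open>\<mu>\<close> and its first entry, so \<open>a \<mapsto> t - a\<close> on the residues, with
  \<open>t = \<mu>\<close> or \<open>t = \<mu> - 1\<close>, induces a length-preserving involution \<open>\<sigma>\<close> of the set of rows. The
  diagrams in question are exactly the sums of blocks \<open>{#r, \<sigma> r#}\<close>, in a unique way, whether or not
  \<open>r\<close> is fixed by \<open>\<sigma>\<close>. A block of row length \<open>\<mu>\<close> has \<open>2\<mu>\<close> boxes, so the generating function is the
  product of the \<open>1 / (1 - x\<^sup>\<mu>)\<close> over all blocks. For each \<open>\<mu>\<close> the number of blocks is half of \<open>m\<close>
  plus the number of solutions of \<open>2a \<equiv> t\<close> modulo \<open>m\<close>: this is \<open>l + 1\<close> for \<open>m = 2l + 1\<close>, and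
  \<open>l + 1\<close> or \<open>l\<close> for \<open>m = 2l\<close>, according to the parity of \<open>t\<close>. Euler's
  \<open>\<Prod> (1 + x\<^sup>k) = \<Prod>\<^bsub>k odd\<^esub> 1 / (1 - x\<^sup>k)\<close> then gives type C, and
  \<open>\<Prod>\<^bsub>k even\<^esub> 1 / (1 - x\<^sup>k) = \<Prod> 1 / ((1 - x\<^sup>k) (1 + x\<^sup>k))\<close> gives type D.
\<close>

section \<open>Generating functions of multisets counted by weight\<close>

text \<open>These are partitions of \<open>n\<close> into coloured parts: a colour \<open>x\<close>
  in \<open>A\<close> stands for a part of size \<open>w x\<close>.\<close>

definition weighted_msets :: "('a \<Rightarrow> nat) \<Rightarrow> 'a set \<Rightarrow> nat \<Rightarrow> 'a multiset set" where
  "weighted_msets w A n = {M. set_mset M \<subseteq> A \<and> (\<Sum>x\<in>#M. w x) = n}"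

lemma finite_weighted_msets:
  assumes "finite A" "\<And>x. x \<in> A \<Longrightarrow> 0 < w x"
  shows "finite (weighted_msets w A n)"
proof (rule finite_subset)
  have "size M \<le> (\<Sum>x\<in>#M. w x)" if "set_mset M \<subseteq> A" for M
    using that
  proof (induction M)
    case (add x M)
    then show ?case using assms(2)[of x] by simp
  qed simp
  then show "weighted_msets w A n \<subseteq> (\<Union>i\<le>n. multisets_of_size A i)"
    by (auto simp: weighted_msets_def multisets_of_size_def)
  show "finite (\<Union>i\<le>n. multisets_of_size A i)"
    using assms(1) by (auto intro: finite_multisets_of_size)
qed

text \<open>Either \<open>b\<close> does not occur, or one copy of it can be removed. The remainder
  may still contain \<open>b\<close>, so \<open>insert b A\<close> reappears on the right; this
  produces a geometric series.\<close>

lemma weighted_msets_insert: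
  assumes "b \<notin> A"
  shows "weighted_msets w (insert b A) n = weighted_msets w A n \<union>
    (if w b \<le> n then add_mset b ` weighted_msets w (insert b A) (n - w b) else {})"
    (is "?L = ?R")
proof
  show "?L \<subseteq> ?R"
  proof
    fix M assume M: "M \<in> ?L"
    show "M \<in> ?R"
    proof (cases "b \<in># M")
      case True
      then obtain M' where "M = add_mset b M'"
        by (meson multi_member_split)
      with M show ?thesis
        by (auto simp: weighted_msets_def)
    qed (use M in \<open>auto simp: weighted_msets_def\<close>)
  qed
  show "?R \<subseteq> ?L"
    by (auto simp: weighted_msets_def split: if_splits)
qed

lemma card_weighted_msets_insert:
  assumes "finite A" "b \<notin> A" "\<And>x. x \<in> insert b A \<Longrightarrow> 0 < w x"
  shows "card (weighted_msets w (insert b A) n) = card (weighted_msets w A n) +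
    (if w b \<le> n then card (weighted_msets w (insert b A) (n - w b)) else 0)"
proof -
  have "weighted_msets w A n \<inter> add_mset b ` X = {}" for X
    using assms(2) by (auto simp: weighted_msets_def)
  moreover have "finite (weighted_msets w (insert b A) k)" "finite (weighted_msets w A k)" for k
    using assms by (auto intro: finite_weighted_msets)
  ultimately show ?thesis
    by (subst weighted_msets_insert[OF assms(2)]) (simp add: card_Un_disjoint card_image inj_on_def)
qed

lemma fps_card_weighted_msets:
  assumes "finite A" "\<And>x. x \<in> A \<Longrightarrow> 0 < w x"
  shows "Abs_fps (\<lambda>n. of_nat (card (weighted_msets w A n)) :: 'b :: field) =
    (\<Prod>x\<in>A. inverse (1 - fps_X ^ w x))"
  using assms
proof (induction A rule: finite_induct)
  case empty
  have "weighted_msets w {} n = (if n = 0 then {{#}} else {})" for n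
    by (auto simp: weighted_msets_def)
  then show ?case
    by (simp add: fps_eq_iff)
next
  case (insert b A)
  define G where "G A = Abs_fps (\<lambda>n. of_nat (card (weighted_msets w A n)) :: 'b)" for A
  have w: "0 < w b"
    using insert.prems by simp
  \<comment> \<open>The recursion for the counts is the coefficient form of a linear equation for
    \<open>G (insert b A)\<close>, which is then solved by inverting
    \<open>1 - fps_X ^ w b\<close>.\<close>
  have "fps_nth (G (insert b A)) n = fps_nth (G A + G (insert b A) * fps_X ^ w b) n" for n
    using card_weighted_msets_insert[OF insert.hyps insert.prems, where n = n]
    by (auto simp: G_def fps_X_power_mult_right_nth)
  then have "G A + G (insert b A) * fps_X ^ w b = G (insert b A)"
    by (simp add: fps_eq_iff)
  then have "G A = G (insert b A) * (1 - fps_X ^ w b)"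
    by (metis add_diff_cancel_right' right_diff_distrib mult_1_right)
  moreover have "(1 - fps_X ^ w b) * inverse (1 - fps_X ^ w b :: 'b fps) = 1"
    by (rule inverse_mult_eq_1') (use w in simp)
  ultimately have "G (insert b A) = G A * inverse (1 - fps_X ^ w b)"
    by (simp add: mult.assoc)
  with insert show ?case
    by (simp add: G_def mult.commute)
qed

text \<open>An element of weight above \<open>N\<close> would alone exceed the total weight. This
  cuts an infinite \<open>A\<close> with finite weight classes down to a finite set.\<close>

lemma weighted_msets_restrict:
  assumes "n \<le> N"
  shows "weighted_msets w A n = weighted_msets w {x \<in> A. w x \<le> N} n"
proof -
  have "w x \<le> N" if "x \<in># M" "(\<Sum>x\<in>#M. w x) = n" for x M
    using that assms by (auto dest!: multi_member_split)
  then show ?thesis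
    by (auto simp: weighted_msets_def)
qed

text \<open>As \<open>A\<close> may be infinite, the comparison is with a finite product and only up
  to degree \<open>N\<close>. Elements of equal weight are collected into one power.\<close>

lemma card_weighted_msets_eq_fps_nth:
  assumes "\<And>x. x \<in> A \<Longrightarrow> 0 < w x" "\<And>k. finite {x \<in> A. w x = k}" "n \<le> N"
  shows "of_nat (card (weighted_msets w A n)) =
    fps_nth (\<Prod>k=1..N. inverse (1 - fps_X ^ k :: 'b :: field fps) ^ card {x \<in> A. w x = k}) n"
proof -
  let ?A = "{x \<in> A. w x \<le> N}"
  have "?A = (\<Union>k\<le>N. {x \<in> A. w x = k})"
    by auto
  then have fin: "finite ?A"
    using assms(2) by simp
  have w: "w ` ?A \<subseteq> {1..N}"
    using assms(1) by (auto simp: Suc_le_eq)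
  have "of_nat (card (weighted_msets w A n)) =
      fps_nth (Abs_fps (\<lambda>n. of_nat (card (weighted_msets w ?A n)) :: 'b)) n"
    using weighted_msets_restrict[OF assms(3), of w A] by simp
  also have "\<dots> = fps_nth (\<Prod>x\<in>?A. inverse (1 - fps_X ^ w x)) n"
    using assms(1) by (subst fps_card_weighted_msets[OF fin]) auto
  also have "(\<Prod>x\<in>?A. inverse (1 - fps_X ^ w x :: 'b fps)) =
      (\<Prod>k=1..N. \<Prod>x\<in>{x \<in> ?A. w x = k}. inverse (1 - fps_X ^ w x))"
    using prod.group[OF fin _ w, of "\<lambda>x. inverse (1 - fps_X ^ w x :: 'b fps)"] by simp
  also have "\<dots> = (\<Prod>k=1..N. inverse (1 - fps_X ^ k) ^ card {x \<in> A. w x = k})"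
  proof (rule prod.cong[OF refl])
    fix k assume "k \<in> {1..N}"
    then have "{x \<in> ?A. w x = k} = {x \<in> A. w x = k}"
      by auto
    then show "(\<Prod>x\<in>{x \<in> ?A. w x = k}. inverse (1 - fps_X ^ w x)) =
        inverse (1 - fps_X ^ k :: 'b fps) ^ card {x \<in> A. w x = k}"
      by simp
  qed
  finally show ?thesis .
qed

section \<open>Multisets symmetric under an involution\<close>

locale involution_on =
  fixes A :: "'a set" and \<sigma> :: "'a \<Rightarrow> 'a"
  assumes closed: "x \<in> A \<Longrightarrow> \<sigma> x \<in> A"
    and involutive: "x \<in> A \<Longrightarrow> \<sigma> (\<sigma> x) = x"
begin

text \<open>A fixed point gives a doubled element, so every block has size 2 and the evenness
  condition needs no separate kind of block.\<close>

definition block :: "'a \<Rightarrow> 'a multiset" where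
  "block x = {#x, \<sigma> x#}"

definition symmetric_msets :: "'a multiset set" where
  "symmetric_msets = {Y. set_mset Y \<subseteq> A \<and>
     (\<forall>x\<in>A. count Y (\<sigma> x) = count Y x \<and> (\<sigma> x = x \<longrightarrow> even (count Y x)))}"

text \<open>Distinct blocks are disjoint: since \<open>\<sigma>\<close> is involutive, any block
  containing \<open>x\<close> is \<open>block x\<close>.\<close>

lemma count_block:
  assumes "x \<in> A" "y \<in> A"
  shows "count (block y) x = (if block y = block x then if \<sigma> x = x then 2 else 1 else 0)"
proof (cases "x \<in># block y")
  case True
  then have "block y = block x"
    using assms involutive[of y] by (auto simp: block_def)
  then show ?thesis
    by (auto simp: block_def)
next
  case False
  moreover from False have "block y \<noteq> block x"
    by (metis block_def union_single_eq_member)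
  ultimately show ?thesis
    by (simp add: not_in_iff)
qed

text \<open>Only the copies of \<open>block x\<close> contribute to \<open>x\<close>. Hence the
  multiplicities in \<open>M\<close> can be read off from its sum, which gives uniqueness of the
  decomposition.\<close>

lemma count_sum_blocks:
  assumes "set_mset M \<subseteq> block ` A" "x \<in> A"
  shows "count (\<Sum>\<^sub># M) x = count M (block x) * (if \<sigma> x = x then 2 else 1)"
  using assms(1)
proof (induction M)
  case (add b M)
  then obtain y where "y \<in> A" "b = block y"
    by auto
  with add assms(2) show ?case
    by (auto simp: count_block)
qed simp

lemma block_subset: "x \<in> A \<Longrightarrow> set_mset (block x) \<subseteq> A"
  using closed by (simp add: block_def)

text \<open>Remove the block of any element of \<open>Y\<close> and induct on the size; the rest is
  again symmetric.\<close>

lemma symmetric_mset_decompose: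
  assumes "Y \<in> symmetric_msets"
  shows "\<exists>M. set_mset M \<subseteq> block ` A \<and> \<Sum>\<^sub># M = Y"
  using assms
proof (induction "size Y" arbitrary: Y rule: less_induct)
  case less
  show ?case
  proof (cases "Y = {#}")
    case True
    then show ?thesis
      by (intro exI[of _ "{#}"]) simp
  next
    case False
    then obtain x where x: "x \<in># Y"
      by blast
    with less.prems have xA: "x \<in> A"
      by (auto simp: symmetric_msets_def)
    have pos: "0 < count Y x"
      using x by simp
    have sym: "count Y (\<sigma> y) = count Y y" "\<sigma> y = y \<Longrightarrow> even (count Y y)" if "y \<in> A" for y
      using less.prems that by (auto simp: symmetric_msets_def)
    \<comment> \<open>The block of a fixed point takes two copies of \<open>x\<close>; a positive
      even count provides them.\<close>
    have ge2: "2 \<le> count Y x" if "\<sigma> x = x"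
      using sym(2)[OF xA that] pos by presburger
    have "count (block x) y \<le> count Y y" for y
      using pos sym(1)[OF xA] ge2 unfolding block_def by (cases "y = x"; cases "y = \<sigma> x") simp_all
    then have sub: "block x \<subseteq># Y"
      by (simp add: subseteq_mset_def)
    have blk: "block (\<sigma> y) = block y" if "y \<in> A" for y
      using that involutive by (simp add: block_def add_mset_commute)
    \<comment> \<open>The block is itself symmetric, so subtracting it preserves equality of counts
      and parity.\<close>
    have "count (block x) (\<sigma> y) = count (block x) y \<and> (\<sigma> y = y \<longrightarrow> even (count (block x) y))"
      if "y \<in> A" for y
      using that xA closed[OF that] blk[OF that] involutive[OF that] by (auto simp: count_block)
    then have "Y - block x \<in> symmetric_msets"
      using less.prems by (auto simp: symmetric_msets_def dest: in_diffD)
    moreover have "size (Y - block x) < size Y"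
      using sub False by (simp add: size_Diff_submset block_def nonempty_has_size)
    ultimately obtain M where "set_mset M \<subseteq> block ` A" "\<Sum>\<^sub># M = Y - block x"
      using less.hyps by blast
    with xA sub show ?thesis
      by (intro exI[of _ "add_mset (block x) M"]) simp
  qed
qed

lemma bij_betw_sum_blocks:
  "bij_betw sum_mset {M. set_mset M \<subseteq> block ` A} symmetric_msets"
  unfolding bij_betw_def
proof
  show "inj_on sum_mset {M. set_mset M \<subseteq> block ` A}"
  proof (rule inj_onI)
    fix M M' assume MM': "M \<in> {M. set_mset M \<subseteq> block ` A}" "M' \<in> {M. set_mset M \<subseteq> block ` A}"
      and eq: "\<Sum>\<^sub># M = \<Sum>\<^sub># M'"
    show "M = M'"
    proof (rule multiset_eqI)
      fix b
      show "count M b = count M' b"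
      proof (cases "b \<in> block ` A")
        case True
        then obtain x where "x \<in> A" "b = block x"
          by blast
        with MM' eq count_sum_blocks[of M x] count_sum_blocks[of M' x] show ?thesis
          by (auto split: if_splits)
      next
        case False
        then have "b \<notin># M" "b \<notin># M'"
          using MM' by auto
        then show ?thesis
          by (simp add: not_in_iff)
      qed
    qed
  qed
  have "\<Sum>\<^sub># M \<in> symmetric_msets" if M: "set_mset M \<subseteq> block ` A" for M
  proof -
    have "set_mset (\<Sum>\<^sub># M) \<subseteq> A"
      using M block_subset by (fastforce simp: in_Union_mset_iff)
    moreover have "block (\<sigma> x) = block x" if "x \<in> A" for x
      using that involutive by (simp add: block_def add_mset_commute)
    ultimately show ?thesis
      using M closed involutive by (auto simp: symmetric_msets_def count_sum_blocks)
  qed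
  moreover have "Y \<in> sum_mset ` {M. set_mset M \<subseteq> block ` A}" if "Y \<in> symmetric_msets" for Y
    using symmetric_mset_decompose[OF that] by blast
  ultimately show "sum_mset ` {M. set_mset M \<subseteq> block ` A} = symmetric_msets"
    by blast
qed

text \<open>Double counting of the total size of all blocks: each block has size 2, while an element
  contributes 2 if it is fixed and 1 otherwise.\<close>

lemma card_blocks:
  assumes "finite A"
  shows "2 * card (block ` A) = card A + card {x \<in> A. \<sigma> x = x}"
proof -
  have "2 * card (block ` A) = (\<Sum>b\<in>block ` A. size b)"
    by (subst sum.cong[of _ _ size "\<lambda>_. 2"]) (auto simp: block_def)
  also have "\<dots> = (\<Sum>b\<in>block ` A. \<Sum>x\<in>A. count b x)"
  proof (rule sum.cong[OF refl])
    fix b assume "b \<in> block ` A"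
    then have "set_mset b \<subseteq> A"
      using block_subset by blast
    then show "size b = (\<Sum>x\<in>A. count b x)"
      unfolding size_multiset_overloaded_eq
      by (intro sum.mono_neutral_left assms) (auto simp: not_in_iff)
  qed
  also have "\<dots> = (\<Sum>x\<in>A. \<Sum>b\<in>block ` A. count b x)"
    by (rule sum.swap)
  also have "\<dots> = (\<Sum>x\<in>A. if \<sigma> x = x then 2 else 1)"
  proof (rule sum.cong[OF refl])
    fix x assume x: "x \<in> A"
    have "(\<Sum>b\<in>block ` A. count b x) =
        (\<Sum>b\<in>block ` A. if b = block x then if \<sigma> x = x then 2 else 1 else 0)"
      using x by (intro sum.cong) (auto simp: count_block)
    with x show "(\<Sum>b\<in>block ` A. count b x) = (if \<sigma> x = x then 2 else 1)"
      using assms by simp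
  qed
  also have "\<dots> = (\<Sum>x\<in>A. 1 + (if \<sigma> x = x then 1 else 0))"
    by (intro sum.cong) auto
  also have "\<dots> = card A + card {x \<in> A. \<sigma> x = x}"
    using assms by (simp only: sum.distrib) (simp add: sum.If_cases Int_def)
  finally show ?thesis .
qed

end

section \<open>Residues and the rows they determine\<close>

lemma inj_on_mod_residues: "inj_on (\<lambda>y. y mod k) {1..k::nat}"
proof (rule inj_onI)
  fix x y assume "x \<in> {1..k}" "y \<in> {1..k}" "x mod k = y mod k"
  then show "x = y"
    by (cases "x = k"; cases "y = k") auto
qed

lemma residue_ex1:
  assumes "0 < (k::nat)"
  shows "\<exists>!y. y \<in> {1..k} \<and> [y = c] (mod k)"
proof (rule ex_ex1I)
  show "\<exists>y. y \<in> {1..k} \<and> [y = c] (mod k)"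
    using assms
    \<comment> \<open>The representatives are \<open>1\<close> to \<open>k\<close>, so the class of
      0 is represented by \<open>k\<close>.\<close>
    by (intro exI[of _ "if c mod k = 0 then k else c mod k"])
      (auto simp: cong_def Suc_le_eq intro: less_imp_le)
  show "x = y" if "x \<in> {1..k} \<and> [x = c] (mod k)" "y \<in> {1..k} \<and> [y = c] (mod k)" for x y
    using that inj_on_mod_residues[of k] by (auto simp: cong_def intro: inj_onD)
qed

lemma residue_reflect_ex1:
  assumes "0 < (m::nat)"
  shows "\<exists>!b. b \<in> {1..m} \<and> [a + b = t] (mod m)"
proof -
  \<comment> \<open>Over the natural numbers, \<open>(m - 1) * a\<close> plays the part of
    \<open>- a\<close> modulo \<open>m\<close>.\<close>
  have "[a + b = t] (mod m) \<longleftrightarrow> [b = t + (m - 1) * a] (mod m)" for b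
  proof -
    have "[a + b = t] (mod m) \<longleftrightarrow> [(m - 1) * a + (a + b) = (m - 1) * a + t] (mod m)"
      by (rule cong_add_lcancel_nat[symmetric])
    also have "(m - 1) * a + (a + b) = m * a + b"
      using assms by (cases m) auto
    also have "[m * a + b = (m - 1) * a + t] (mod m) \<longleftrightarrow> [b = t + (m - 1) * a] (mod m)"
      by (simp add: cong_def add.commute)
    finally show ?thesis .
  qed
  then show ?thesis
    using residue_ex1[OF assms] by simp
qed

lemma residue_step_ex1:
  assumes "0 < k" "x \<in> {1..k}"
  shows "\<exists>!y. y \<in> {1..k} \<and> residue_step s k x y"
proof (cases s)
  case Sign_plus
  obtain x' where x': "x = x' + 1"
    using assms(2) by (cases x) auto
  have "residue_step s k x y \<longleftrightarrow> [y = x'] (mod k)" for y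
    unfolding Sign_plus residue_step.simps x' cong_add_rcancel_nat by (rule cong_sym_eq)
  then show ?thesis
    using residue_ex1[OF assms(1)] by simp
next
  case Sign_minus
  then show ?thesis
    using residue_ex1[OF assms(1)] by simp
qed

lemma diagram_row_Cons:
  "diagram_row s k (x # r) \<longleftrightarrow>
    x \<in> {1..k} \<and> (r = [] \<or> diagram_row s k r \<and> residue_step s k x (hd r))"
  by (cases r) (auto simp: diagram_row_def)

lemma diagram_row_hd: "diagram_row s k r \<Longrightarrow> hd r \<in> {1..k}"
  by (cases r) (auto simp: diagram_row_def)

lemma diagram_row_length: "diagram_row s k r \<Longrightarrow> 0 < length r"
  by (auto simp: diagram_row_def)

text \<open>Each box determines the next one by \<open>residue_step_ex1\<close>, so a row grows
  uniquely from its first entry; the induction is on the length.\<close>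

lemma diagram_row_ex1:
  assumes "0 < k" "0 < \<mu>" "a \<in> {1..k}"
  shows "\<exists>!r. diagram_row s k r \<and> length r = \<mu> \<and> hd r = a"
  using assms(2,3)
proof (induction \<mu> arbitrary: a rule: nat_induct_non_zero)
  case 1
  then show ?case
    by (intro ex1I[of _ "[a]"]) (auto simp: diagram_row_Cons length_Suc_conv)
next
  case (Suc n)
  from residue_step_ex1[OF assms(1) Suc.prems, of s]
  obtain b where b: "b \<in> {1..k}" "residue_step s k a b"
    and b_unique: "\<And>y. y \<in> {1..k} \<Longrightarrow> residue_step s k a y \<Longrightarrow> y = b"
    by blast
  from Suc.IH[OF b(1)]
  obtain r where r: "diagram_row s k r" "length r = n" "hd r = b"
    and r_unique: "\<And>r'. diagram_row s k r' \<Longrightarrow> length r' = n \<Longrightarrow> hd r' = b \<Longrightarrow> r' = r"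
    by blast
  show ?case
  proof (rule ex1I[of _ "a # r"])
    show "diagram_row s k (a # r) \<and> length (a # r) = Suc n \<and> hd (a # r) = a"
      using r b Suc.prems by (simp add: diagram_row_Cons)
    fix r' assume r': "diagram_row s k r' \<and> length r' = Suc n \<and> hd r' = a"
    then obtain q where q: "r' = a # q" "length q = n"
      by (cases r') auto
    with r' Suc.hyps have "diagram_row s k q" "residue_step s k a (hd q)"
      by (auto simp: diagram_row_Cons)
    with q b_unique[OF diagram_row_hd] r_unique show "r' = a # r"
      by blast
  qed
qed

lemma diagram_row_eqI:
  assumes "diagram_row s k r" "diagram_row s k r'" "length r = length r'" "hd r = hd r'"
  shows "r = r'"
proof -
  have "0 < k"
    using diagram_row_hd[OF assms(1)] by auto
  then show ?thesis
    using diagram_row_ex1[OF _ diagram_row_length[OF assms(1)] diagram_row_hd[OF assms(1)]] assms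
    by metis
qed

lemma bij_betw_hd_diagram_rows:
  assumes "0 < k" "0 < \<mu>"
  shows "bij_betw hd {r. diagram_row s k r \<and> length r = \<mu>} {1..k}"
  unfolding bij_betw_def
proof
  show "inj_on hd {r. diagram_row s k r \<and> length r = \<mu>}"
    by (auto intro!: inj_onI diagram_row_eqI)
  show "hd ` {r. diagram_row s k r \<and> length r = \<mu>} = {1..k}"
  proof
    show "hd ` {r. diagram_row s k r \<and> length r = \<mu>} \<subseteq> {1..k}"
      using diagram_row_hd by blast
    show "{1..k} \<subseteq> hd ` {r. diagram_row s k r \<and> length r = \<mu>}"
      using diagram_row_ex1[OF assms] by (fastforce simp: image_iff)
  qed
qed

text \<open>Length and first entry determine a row, so the filter in \<open>row_mult\<close> selects
  the copies of a single row.\<close>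

lemma row_mult_eq_count:
  assumes "young_diagram s k Y" "diagram_row s k r"
  shows "row_mult Y (length r) (hd r) = count Y r"
proof -
  have "{#r' \<in># Y. length r' = length r \<and> hd r' = hd r#} = {#r' \<in># Y. r' = r#}"
    using assms by (intro filter_mset_cong refl) (auto simp: young_diagram_def intro: diagram_row_eqI)
  then show ?thesis
    by (simp add: row_mult_def filter_eq_replicate_mset)
qed

section \<open>Counting diagrams by blocks of rows\<close>

text \<open>Common form of the three families: \<open>t\<close> is the identity for types A and D,
  and the predecessor for type C.\<close>

definition symmetric_diagrams ::
    "dsign \<Rightarrow> nat \<Rightarrow> (nat \<Rightarrow> nat) \<Rightarrow> nat \<Rightarrow> nat list multiset set" where
  "symmetric_diagrams s m t N = {Y. young_diagram s m Y \<and> boxes Y = N \<and>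
     (\<forall>\<mu>\<in>row_lengths Y.
        (\<forall>a\<in>{1..m}. \<forall>b\<in>{1..m}. [a + b = t \<mu>] (mod m) \<longrightarrow> row_mult Y \<mu> a = row_mult Y \<mu> b) \<and>
        (\<forall>a\<in>{1..m}. [2 * a = t \<mu>] (mod m) \<longrightarrow> even (row_mult Y \<mu> a)))}"

text \<open>The reflection of first entries lifts to rows, because there is one row for each length
  and first entry.\<close>

lemma row_reflection_exists:
  assumes "0 < m"
  obtains \<sigma> where "\<And>r. diagram_row s m r \<Longrightarrow> diagram_row s m (\<sigma> r)"
    and "\<And>r. diagram_row s m r \<Longrightarrow> length (\<sigma> r) = length r"
    and "\<And>r. diagram_row s m r \<Longrightarrow> [hd r + hd (\<sigma> r) = t (length r)] (mod m)"
proof -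
  have "\<exists>r'. diagram_row s m r' \<and> length r' = length r \<and> [hd r + hd r' = t (length r)] (mod m)"
    if "diagram_row s m r" for r
    using residue_reflect_ex1[OF assms, of "hd r" "t (length r)"]
      diagram_row_ex1[OF assms diagram_row_length[OF that], of _ s]
    by metis
  then show ?thesis
    using that by metis
qed

lemma card_symmetric_diagrams:
  assumes m: "0 < m" and "n \<le> N"
  shows "of_nat (card (symmetric_diagrams s m t (2 * n))) =
    fps_nth (\<Prod>k=1..N. inverse (1 - fps_X ^ k :: 'b :: field fps)
      ^ ((m + card {a \<in> {1..m}. [2 * a = t k] (mod m)}) div 2)) n"
proof -
  obtain \<sigma> where row_\<sigma>: "\<And>r. diagram_row s m r \<Longrightarrow> diagram_row s m (\<sigma> r)"
    and length_\<sigma>: "\<And>r. diagram_row s m r \<Longrightarrow> length (\<sigma> r) = length r"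
    and hd_\<sigma>: "\<And>r. diagram_row s m r \<Longrightarrow> [hd r + hd (\<sigma> r) = t (length r)] (mod m)"
    using row_reflection_exists[OF m] by metis
  \<comment> \<open>The reflected first entry is unique, so these conditions characterise
    \<open>\<sigma> r\<close>.\<close>
  have \<sigma>_eqI: "\<sigma> r = q" if "diagram_row s m r" "diagram_row s m q" "length q = length r"
    "[hd r + hd q = t (length r)] (mod m)" for r q
  proof (rule diagram_row_eqI)
    show "hd (\<sigma> r) = hd q"
      using residue_reflect_ex1[OF m, of "hd r" "t (length r)"] that row_\<sigma> hd_\<sigma> diagram_row_hd
      by blast
  qed (use that row_\<sigma> length_\<sigma> in auto)
  define R where "R = {r. diagram_row s m r}"
  have mem_R: "r \<in> R \<longleftrightarrow> diagram_row s m r" for r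
    by (simp add: R_def)
  \<comment> \<open>Both rows of a block have the same length, so this weight is that length;
    \<open>2 * n\<close> boxes become total weight \<open>n\<close>.\<close>
  define w where "w b = boxes b div 2" for b :: "nat list multiset"
  interpret R: involution_on R \<sigma>
  proof
    fix r assume "r \<in> R"
    then show "\<sigma> r \<in> R" "\<sigma> (\<sigma> r) = r"
      using row_\<sigma> length_\<sigma> hd_\<sigma> by (auto simp: mem_R add.commute intro!: \<sigma>_eqI)
  qed

  have symmetric: "symmetric_diagrams s m t K = {Y \<in> R.symmetric_msets. boxes Y = K}" for K
  proof (intro equalityI subsetI)
    fix Y assume Y: "Y \<in> symmetric_diagrams s m t K"
    then have yd: "young_diagram s m Y"
      by (simp add: symmetric_diagrams_def)
    \<comment> \<open>The diagram conditions speak only of row lengths occurring in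
      \<open>Y\<close>. If neither \<open>r\<close> nor \<open>\<sigma> r\<close> occurs, both
      counts are 0.\<close>
    have "count Y (\<sigma> r) = count Y r \<and> (\<sigma> r = r \<longrightarrow> even (count Y r))" if "r \<in> R" for r
    proof (cases "r \<in># Y \<or> \<sigma> r \<in># Y")
      case True
      have r: "diagram_row s m r" "diagram_row s m (\<sigma> r)"
        using that row_\<sigma> by (auto simp: mem_R)
      from True have "length r \<in> row_lengths Y"
        unfolding row_lengths_def using length_\<sigma>[OF r(1)] by (metis image_eqI)
      then have cond: "\<And>a b. a \<in> {1..m} \<Longrightarrow> b \<in> {1..m} \<Longrightarrow> [a + b = t (length r)] (mod m) \<Longrightarrow>
            row_mult Y (length r) a = row_mult Y (length r) b"
          "\<And>a. a \<in> {1..m} \<Longrightarrow> [2 * a = t (length r)] (mod m) \<Longrightarrow> even (row_mult Y (length r) a)"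
        using Y unfolding symmetric_diagrams_def by blast+
      have "row_mult Y (length r) (hd r) = row_mult Y (length r) (hd (\<sigma> r))"
        by (rule cond(1)[OF diagram_row_hd[OF r(1)] diagram_row_hd[OF r(2)] hd_\<sigma>[OF r(1)]])
      moreover have "even (row_mult Y (length r) (hd r))" if "\<sigma> r = r"
        using cond(2)[OF diagram_row_hd[OF r(1)]] hd_\<sigma>[OF r(1)] that by (simp add: mult_2)
      ultimately show ?thesis
        using row_mult_eq_count[OF yd r(1)] row_mult_eq_count[OF yd r(2)] length_\<sigma>[OF r(1)]
        by metis
    next
      case False
      then show ?thesis
        by (simp add: not_in_iff)
    qed
    with Y show "Y \<in> {Y \<in> R.symmetric_msets. boxes Y = K}"
      by (auto simp: symmetric_diagrams_def young_diagram_def R.symmetric_msets_def mem_R)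
  next
    fix Y assume Y: "Y \<in> {Y \<in> R.symmetric_msets. boxes Y = K}"
    then have yd: "young_diagram s m Y"
      by (auto simp: R.symmetric_msets_def mem_R young_diagram_def)
    have "(\<forall>b\<in>{1..m}. [a + b = t \<mu>] (mod m) \<longrightarrow> row_mult Y \<mu> a = row_mult Y \<mu> b) \<and>
        ([2 * a = t \<mu>] (mod m) \<longrightarrow> even (row_mult Y \<mu> a))"
      if "\<mu> \<in> row_lengths Y" "a \<in> {1..m}" for \<mu> a
    proof -
      have \<mu>: "0 < \<mu>"
        using that(1) yd diagram_row_length by (fastforce simp: row_lengths_def young_diagram_def)
      obtain r where r: "diagram_row s m r" "length r = \<mu>" "hd r = a"
        using diagram_row_ex1[OF m \<mu> \<open>a \<in> {1..m}\<close>] by blast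
      have count: "count Y (\<sigma> r) = count Y r" "\<sigma> r = r \<longrightarrow> even (count Y r)"
        using Y r by (auto simp: R.symmetric_msets_def mem_R)
      have "row_mult Y \<mu> a = row_mult Y \<mu> b" if "b \<in> {1..m}" "[a + b = t \<mu>] (mod m)" for b
      proof -
        obtain q where q: "diagram_row s m q" "length q = \<mu>" "hd q = b"
          using diagram_row_ex1[OF m \<mu> \<open>b \<in> {1..m}\<close>] by blast
        then have "\<sigma> r = q"
          using r that by (intro \<sigma>_eqI) auto
        then show ?thesis
          using count(1) row_mult_eq_count[OF yd r(1)] row_mult_eq_count[OF yd q(1)] r q by simp
      qed
      moreover have "even (row_mult Y \<mu> a)" if "[2 * a = t \<mu>] (mod m)"
      proof -
        have "\<sigma> r = r"
          using r that by (intro \<sigma>_eqI) (auto simp: mult_2)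
        then show ?thesis
          using count(2) row_mult_eq_count[OF yd r(1)] r by simp
      qed
      ultimately show ?thesis
        by blast
    qed
    with Y yd show "Y \<in> symmetric_diagrams s m t K"
      by (auto simp: symmetric_diagrams_def)
  qed

  have boxes_block: "boxes (R.block r) = 2 * length r" if "r \<in> R" for r
    using that length_\<sigma> by (simp add: R.block_def boxes_def mem_R)
  then have w_block: "w (R.block r) = length r" if "r \<in> R" for r
    using that by (simp add: w_def)
  have boxes_sum: "boxes (\<Sum>\<^sub># M) = 2 * (\<Sum>b\<in>#M. w b)" if "set_mset M \<subseteq> R.block ` R" for M
    using that
  proof (induction M)
    case (add b M)
    moreover have "boxes (Y + Z) = boxes Y + boxes Z" for Y Z
      by (simp add: boxes_def)
    ultimately show ?case
      using boxes_block w_block by auto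
  qed (simp add: boxes_def)
  have "bij_betw sum_mset (weighted_msets w (R.block ` R) n) (symmetric_diagrams s m t (2 * n))"
  proof (rule bij_betw_subset[OF R.bij_betw_sum_blocks])
    show "sum_mset ` weighted_msets w (R.block ` R) n = symmetric_diagrams s m t (2 * n)"
      unfolding symmetric bij_betw_imp_surj_on[OF R.bij_betw_sum_blocks, symmetric]
      by (auto simp: weighted_msets_def boxes_sum)
  qed (auto simp: weighted_msets_def)
  then have card_eq: "card (symmetric_diagrams s m t (2 * n)) = card (weighted_msets w (R.block ` R) n)"
    by (metis bij_betw_same_card)

  have blocks: "{b \<in> R.block ` R. w b = k} = R.block ` {r \<in> R. length r = k}" for k
    using w_block by auto
  have rows: "bij_betw hd {r \<in> R. length r = k} {1..m}" if "0 < k" for k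
    using bij_betw_hd_diagram_rows[OF m that, of s] by (simp add: mem_R)
  have fin: "finite {r \<in> R. length r = k}" for k
  proof (cases "k = 0")
    case False
    then show ?thesis
      using rows bij_betw_finite by blast
  qed (use diagram_row_length in \<open>auto simp: mem_R\<close>)
  have card_blocks: "card {b \<in> R.block ` R. w b = k} =
      (m + card {a \<in> {1..m}. [2 * a = t k] (mod m)}) div 2" if k: "0 < k" for k
  proof -
    let ?R = "{r \<in> R. length r = k}"
    \<comment> \<open>The set of all rows is infinite, so \<open>card_blocks\<close> is applied to
      the rows of length \<open>k\<close>. The blocks are the same since \<open>block\<close>
      depends on \<open>\<sigma>\<close> alone.\<close>
    interpret Rk: involution_on ?R \<sigma>
      by standard (auto simp: R.closed R.involutive length_\<sigma> mem_R row_\<sigma>)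
    \<comment> \<open>A row is fixed exactly when its first entry is its own reflection.\<close>
    have "bij_betw hd {r \<in> ?R. \<sigma> r = r} {a \<in> {1..m}. [2 * a = t k] (mod m)}"
    proof (rule bij_betw_subset[OF rows[OF k]])
      have "\<sigma> r = r \<longleftrightarrow> [2 * hd r = t k] (mod m)" if "r \<in> ?R" for r
        using that hd_\<sigma>[of r] \<sigma>_eqI[of r r] by (auto simp: mem_R mult_2)
      then show "hd ` {r \<in> ?R. \<sigma> r = r} = {a \<in> {1..m}. [2 * a = t k] (mod m)}"
        unfolding bij_betw_imp_surj_on[OF rows[OF k], symmetric] by auto
    qed auto
    then have "2 * card (R.block ` ?R) = m + card {a \<in> {1..m}. [2 * a = t k] (mod m)}"
      using Rk.card_blocks[OF fin] bij_betw_same_card[OF rows[OF k]] bij_betw_same_card by fastforce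
    then show ?thesis
      unfolding blocks by simp
  qed

  have "0 < w b" if "b \<in> R.block ` R" for b
    using that w_block diagram_row_length by (auto simp: mem_R)
  moreover have "finite {b \<in> R.block ` R. w b = k}" for k
    unfolding blocks using fin by simp
  ultimately have "of_nat (card (weighted_msets w (R.block ` R) n)) = fps_nth
      (\<Prod>k=1..N. inverse (1 - fps_X ^ k :: 'b fps) ^ card {b \<in> R.block ` R. w b = k}) n"
    using \<open>n \<le> N\<close> by (rule card_weighted_msets_eq_fps_nth)
  also have "(\<Prod>k=1..N. inverse (1 - fps_X ^ k :: 'b fps) ^ card {b \<in> R.block ` R. w b = k}) =
      (\<Prod>k=1..N. inverse (1 - fps_X ^ k)
        ^ ((m + card {a \<in> {1..m}. [2 * a = t k] (mod m)}) div 2))"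
    by (intro prod.cong refl) (simp add: card_blocks)
  finally show ?thesis
    unfolding card_eq .
qed

section \<open>Solutions of \<open>2 * a = t\<close> modulo \<open>m\<close>\<close>

text \<open>Here 2 is invertible, with inverse \<open>l + 1\<close> modulo
  \<open>2 * l + 1\<close>.\<close>

lemma card_halves_odd:
  "card {a \<in> {1..2 * l + 1}. [2 * a = (t :: nat)] (mod (2 * l + 1))} = 1"
proof -
  have "[2 * a = t] (mod (2 * l + 1)) \<longleftrightarrow> [a = (l + 1) * t] (mod (2 * l + 1))" for a
  proof
    assume "[2 * a = t] (mod (2 * l + 1))"
    then have "[(l + 1) * (2 * a) = (l + 1) * t] (mod (2 * l + 1))"
      by (rule cong_scalar_left)
    moreover have "(l + 1) * (2 * a) = a + (2 * l + 1) * a"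
      by (simp add: algebra_simps)
    ultimately show "[a = (l + 1) * t] (mod (2 * l + 1))"
      unfolding cong_def by (metis mod_mult_self2)
  next
    assume "[a = (l + 1) * t] (mod (2 * l + 1))"
    then have "[2 * a = 2 * ((l + 1) * t)] (mod (2 * l + 1))"
      by (rule cong_scalar_left)
    moreover have "2 * ((l + 1) * t) = t + (2 * l + 1) * t"
      by (simp add: algebra_simps)
    ultimately show "[2 * a = t] (mod (2 * l + 1))"
      unfolding cong_def by (metis mod_mult_self2)
  qed
  moreover obtain y where "{a \<in> {1..2 * l + 1}. [a = (l + 1) * t] (mod (2 * l + 1))} = {y}"
    using residue_ex1[of "2 * l + 1" "(l + 1) * t"] by auto
  ultimately show ?thesis
    by simp
qed

text \<open>For even \<open>t\<close>, halving leaves one congruence modulo \<open>l\<close>, whose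
  class meets \<open>{1..2 * l}\<close> in two points \<open>y\<close> and \<open>y + l\<close>. For
  odd \<open>t\<close>, parity excludes solutions.\<close>

lemma card_halves_even:
  assumes "1 \<le> l"
  shows "card {a \<in> {1..2 * l}. [2 * a = (t :: nat)] (mod (2 * l))} = (if even t then 2 else 0)"
proof (cases "even t")
  case True
  then obtain u where u: "t = 2 * u"
    by blast
  have cong: "[2 * a = t] (mod (2 * l)) \<longleftrightarrow> [a = u] (mod l)" for a
    unfolding u cong_def by simp
  from residue_ex1[of l u] assms obtain y where y: "y \<in> {1..l}" "[y = u] (mod l)"
    and y_unique: "\<And>z. z \<in> {1..l} \<Longrightarrow> [z = u] (mod l) \<Longrightarrow> z = y"
    by (metis less_le_trans zero_less_one)
  have "a = y \<or> a = y + l" if "a \<in> {1..2 * l}" "[a = u] (mod l)" for a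
  proof (cases "a \<le> l")
    case False
    then have "a - l \<in> {1..l}" "[a - l = u] (mod l)"
      using that by (auto simp: cong_def le_mod_geq)
    then show ?thesis
      using y_unique False by fastforce
  qed (use that y_unique in auto)
  moreover have "[y + l = u] (mod l)"
    using y(2) by (simp add: cong_def)
  ultimately have "{a \<in> {1..2 * l}. [2 * a = t] (mod (2 * l))} = {y, y + l}"
    unfolding cong using y by auto
  then show ?thesis
    using True assms by simp
next
  case False
  have "\<not> [2 * a = t] (mod (2 * l))" for a
    using False cong_dvd_modulus_nat[of "2 * a" t "2 * l" 2] cong_dvd_iff[of "2 * a" t 2] by auto
  with False show ?thesis
    by simp
qed

section \<open>Infinite products of power series and their truncations\<close>

lemma has_prod_fpsI:
  fixes f :: "nat \<Rightarrow> 'a :: comm_ring_1 fps"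
  assumes "\<And>N n. n \<le> N \<Longrightarrow> fps_nth (\<Prod>k=1..N. f k) n = fps_nth G n"
  shows "(\<lambda>k. f (Suc k)) has_prod G"
proof -
  have "(\<lambda>N. \<Prod>k\<le>N. f (Suc k)) \<longlonglongrightarrow> G"
  proof (rule tendsto_fpsI)
    fix n
    show "\<forall>\<^sub>F N in sequentially. fps_nth (\<Prod>k\<le>N. f (Suc k)) n = fps_nth G n"
      using eventually_ge_at_top[of n]
    proof eventually_elim
      case (elim N)
      \<comment> \<open>Partial products in \<open>has_prod\<close> start at index 0 and include
        \<open>N\<close>, so after the shift they end at \<open>Suc N\<close>.\<close>
      have "(\<Prod>k\<le>N. f (Suc k)) = (\<Prod>k=1..Suc N. f k)"
        by (simp only: prod.atLeast1_atMost_eq lessThan_Suc_atMost One_nat_def)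
      with elim show ?case
        using assms[of n "Suc N"] by simp
    qed
  qed
  moreover have "G \<noteq> 0"
    using assms[of 0 0] by auto
  ultimately show ?thesis
    by (simp add: has_prod_def raw_has_prod_def)
qed

text \<open>Each factor changes the series only by a multiple of a power of \<open>fps_X\<close>
  beyond degree \<open>n\<close>.\<close>

lemma fps_nth_mult_prod_one_minus_X_power:
  fixes F :: "'a :: comm_ring_1 fps"
  assumes "finite S" "\<And>k. k \<in> S \<Longrightarrow> n < w k"
  shows "fps_nth (F * (\<Prod>k\<in>S. 1 - fps_X ^ w k)) n = fps_nth F n"
  using assms
proof (induction S rule: finite_induct)
  case (insert k S)
  define P where "P = F * (\<Prod>k\<in>S. 1 - fps_X ^ w k)"
  have "F * (\<Prod>k\<in>insert k S. 1 - fps_X ^ w k) = P - P * fps_X ^ w k"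
    using insert.hyps by (simp add: P_def algebra_simps)
  with insert show ?case
    by (simp add: P_def fps_X_power_mult_right_nth)
qed simp

text \<open>Doubling maps the indices with \<open>2 * k \<le> N\<close> onto the even numbers up to
  \<open>N\<close>; the others overshoot the truncation and form a separate factor.\<close>

lemma prod_even_split:
  fixes g :: "nat \<Rightarrow> 'a :: comm_monoid_mult"
  shows "(\<Prod>k=1..N. g (2 * k)) =
    (\<Prod>k | k \<in> {1..N} \<and> even k. g k) * (\<Prod>k | k \<in> {1..N} \<and> N < 2 * k. g (2 * k))"
proof -
  have "(\<Prod>k=1..N. g (2 * k)) = (\<Prod>k | k \<in> {1..N} \<and> 2 * k \<le> N. g (2 * k)) *
      (\<Prod>k | k \<in> {1..N} \<and> N < 2 * k. g (2 * k))"
    by (subst prod.union_disjoint[symmetric]) (auto intro!: prod.cong)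
  also have "(\<Prod>k | k \<in> {1..N} \<and> 2 * k \<le> N. g (2 * k)) = (\<Prod>k | k \<in> {1..N} \<and> even k. g k)"
    by (rule prod.reindex_bij_witness[of _ "\<lambda>k. k div 2" "\<lambda>k. 2 * k"]) auto
  finally show ?thesis .
qed

lemma prod_odd_even_split:
  fixes g :: "nat \<Rightarrow> 'a :: comm_monoid_mult"
  shows "(\<Prod>k=1..N. g k) =
    (\<Prod>k | k \<in> {1..N} \<and> odd k. g k) * (\<Prod>k | k \<in> {1..N} \<and> even k. g k)"
  by (subst prod.union_disjoint[symmetric]) (auto intro!: prod.cong)

lemma one_plus_X_power_mult_one_minus:
  "(1 + fps_X ^ k) * (1 - fps_X ^ k) = (1 - fps_X ^ (2 * k) :: 'a :: comm_ring_1 fps)"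
proof -
  have "(1 + x) * (1 - x) = 1 - x * x" for x :: "'a fps"
    by (simp add: algebra_simps)
  then show ?thesis
    by (simp only: mult_2 power_add)
qed

text \<open>Euler's identity between partitions into distinct parts and partitions into odd parts,
  truncated at parts of size \<open>N\<close>; the last factor is \<open>1\<close> up to degree \<open>N\<close>.\<close>

lemma euler_distinct_odd_truncated:
  "(\<Prod>k=1..N. 1 + fps_X ^ k :: 'a :: field fps) =
    (\<Prod>k | k \<in> {1..N} \<and> odd k. inverse (1 - fps_X ^ k)) *
    (\<Prod>k | k \<in> {1..N} \<and> N < 2 * k. 1 - fps_X ^ (2 * k))"
proof -
  let ?g = "\<lambda>k. 1 - fps_X ^ k :: 'a fps"
  let ?odd = "{k. k \<in> {1..N} \<and> odd k}" and ?even = "{k. k \<in> {1..N} \<and> even k}"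
    and ?large = "{k. k \<in> {1..N} \<and> N < 2 * k}"
  have nth_0: "fps_nth (?g k) 0 \<noteq> 0" if "k \<in> {1..N}" for k
    using that by simp
  then have nz: "?g k \<noteq> 0" if "k \<in> {1..N}" for k
    using that by (metis fps_zero_nth)
  \<comment> \<open>Multiplying by all \<open>?g k\<close> turns the factors into
    \<open>?g (2 * k)\<close>. Those with \<open>2 * k \<le> N\<close> are the even factors
    \<open>?g k\<close>, which then cancel.\<close>
  have "(\<Prod>k=1..N. 1 + fps_X ^ k) * (\<Prod>k=1..N. ?g k) = (\<Prod>k=1..N. ?g (2 * k))"
    by (simp only: one_plus_X_power_mult_one_minus flip: prod.distrib)
  then have "((\<Prod>k=1..N. 1 + fps_X ^ k) * prod ?g ?odd) * prod ?g ?even =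
      (\<Prod>k\<in>?large. ?g (2 * k)) * prod ?g ?even"
    unfolding prod_even_split[of ?g N] prod_odd_even_split[of ?g N] by (simp only: ac_simps)
  moreover have "finite ?even"
    by simp
  then have "prod ?g ?even \<noteq> 0"
    using nz by (subst prod_zero_iff) blast+
  ultimately have prod_odd: "(\<Prod>k=1..N. 1 + fps_X ^ k) * prod ?g ?odd = (\<Prod>k\<in>?large. ?g (2 * k))"
    unfolding mult_cancel_right by blast
  have "prod ?g ?odd * (\<Prod>k\<in>?odd. inverse (?g k)) = 1"
    unfolding prod.distrib[symmetric]
    by (intro prod.neutral ballI inverse_mult_eq_1' nth_0) blast
  then have "(\<Prod>k=1..N. 1 + fps_X ^ k) =
      ((\<Prod>k=1..N. 1 + fps_X ^ k) * prod ?g ?odd) * (\<Prod>k\<in>?odd. inverse (?g k))"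
    by (simp only: mult.assoc mult_1_right)
  then show ?thesis
    by (simp only: prod_odd mult.commute)
qed

section \<open>The product formulas for the three types\<close>

text \<open>The truncated products are compared only up to degree \<open>N\<close>, since in types C
  and D they differ in higher degrees.\<close>

lemma has_prod_card_symmetric_diagrams:
  fixes f :: "nat \<Rightarrow> 'a :: field fps"
  assumes "0 < m"
    and "\<And>N n. n \<le> N \<Longrightarrow> fps_nth (\<Prod>k=1..N. f k) n =
      fps_nth (\<Prod>k=1..N. inverse (1 - fps_X ^ k)
        ^ ((m + card {a \<in> {1..m}. [2 * a = t k] (mod m)}) div 2)) n"
  shows "(\<lambda>k. f (Suc k)) has_prod
    Abs_fps (\<lambda>n. of_nat (card (symmetric_diagrams s m t (2 * n))))"
  using assms card_symmetric_diagrams[OF assms(1), where 'b = 'a] by (intro has_prod_fpsI) simp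

lemma prod_power_if_split:
  fixes g :: "nat \<Rightarrow> 'a :: comm_monoid_mult"
  shows "(\<Prod>k=1..N. g k ^ (l + (if P k then 1 else 0))) =
    (\<Prod>k=1..N. g k ^ l) * (\<Prod>k | k \<in> {1..N} \<and> P k. g k)"
proof -
  have "(\<Prod>k=1..N. g k ^ (l + (if P k then 1 else 0))) =
      (\<Prod>k=1..N. g k ^ l * (if P k then g k else 1))"
    by (intro prod.cong) (auto simp: mult.commute)
  moreover have "(\<Prod>k=1..N. if P k then g k else 1) = (\<Prod>k | k \<in> {1..N} \<and> P k. g k)"
    by (simp add: prod.If_cases Int_def)
  ultimately show ?thesis
    by (simp add: prod.distrib)
qed

lemma prod_Sigma_A:
  "(\<lambda>k. 1 / (1 - fps_X ^ Suc k) ^ (l + 1) :: 'a :: field fps) has_prod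
    Abs_fps (\<lambda>n. of_nat (card (Sigma_A s (2 * l + 1) (2 * n))))"
proof -
  define f :: "nat \<Rightarrow> 'a fps" where "f k = 1 / (1 - fps_X ^ k) ^ (l + 1)" for k
  have f: "f k = inverse (1 - fps_X ^ k) ^ (l + 1)" if "0 < k" for k
    using that by (simp add: f_def fps_divide_unit fps_inverse_power fps_inverse_mult)
  have "(\<lambda>k. f (Suc k)) has_prod
      Abs_fps (\<lambda>n. of_nat (card (symmetric_diagrams s (2 * l + 1) id (2 * n))))"
  proof (rule has_prod_card_symmetric_diagrams)
    show "fps_nth (\<Prod>k=1..N. f k) n = fps_nth (\<Prod>k=1..N. inverse (1 - fps_X ^ k) ^ ((2 * l + 1 +
        card {a \<in> {1..2 * l + 1}. [2 * a = id k] (mod (2 * l + 1))}) div 2)) n" for N n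
      unfolding card_halves_odd by (simp add: f)
  qed simp
  then show ?thesis
    by (simp add: f_def Sigma_A_def symmetric_diagrams_def)
qed

text \<open>There are \<open>l + 1\<close> blocks for odd row length and \<open>l\<close> for even;
  Euler's identity turns the extra odd factors into those of \<open>1 + fps_X ^ k\<close>.\<close>

lemma prod_Sigma_C:
  assumes "1 \<le> l"
  shows "(\<lambda>k. (1 + fps_X ^ Suc k) / (1 - fps_X ^ Suc k) ^ l :: 'a :: field fps) has_prod
    Abs_fps (\<lambda>n. of_nat (card (Sigma_C s (2 * l) (2 * n))))"
proof -
  define t :: "nat \<Rightarrow> nat" where "t k = k - 1" for k
  define f :: "nat \<Rightarrow> 'a fps" where "f k = (1 + fps_X ^ k) / (1 - fps_X ^ k) ^ l" for k
  have "(\<lambda>k. f (Suc k)) has_prod Abs_fps (\<lambda>n. of_nat (card (symmetric_diagrams s (2 * l) t (2 * n))))"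
  proof (rule has_prod_card_symmetric_diagrams)
    show "0 < 2 * l"
      using assms by simp
    fix N n :: nat assume "n \<le> N"
    have "f k = inverse (1 - fps_X ^ k) ^ l * (1 + fps_X ^ k)" if "0 < k" for k
      using that by (simp add: f_def fps_divide_unit fps_inverse_power mult.commute)
    then have "(\<Prod>k=1..N. f k) = (\<Prod>k=1..N. inverse (1 - fps_X ^ k) ^ l) * (\<Prod>k=1..N. 1 + fps_X ^ k)"
      by (simp flip: prod.distrib)
    then have "fps_nth (\<Prod>k=1..N. f k) n = fps_nth ((\<Prod>k=1..N. inverse (1 - fps_X ^ k) ^ l) *
        (\<Prod>k | k \<in> {1..N} \<and> odd k. inverse (1 - fps_X ^ k))) n"
      \<comment> \<open>The last factor in Euler's truncated identity involves only exponents
        \<open>2 * k > N \<ge> n\<close>, so coefficient \<open>n\<close> does not see it.\<close>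
      unfolding euler_distinct_odd_truncated mult.assoc[symmetric] using \<open>n \<le> N\<close>
      by (simp only:) (rule fps_nth_mult_prod_one_minus_X_power; simp)
    also have "\<dots> = fps_nth (\<Prod>k=1..N. inverse (1 - fps_X ^ k) ^ (l + (if odd k then 1 else 0))) n"
      by (simp only: prod_power_if_split)
    also have "(\<Prod>k=1..N. inverse (1 - fps_X ^ k :: 'a fps) ^ (l + (if odd k then 1 else 0))) =
        (\<Prod>k=1..N. inverse (1 - fps_X ^ k)
          ^ ((2 * l + card {a \<in> {1..2 * l}. [2 * a = t k] (mod (2 * l))}) div 2))"
      \<comment> \<open>In the range \<open>k \<ge> 1\<close>, the predecessor of \<open>k\<close>
        is even exactly when \<open>k\<close> is odd.\<close>
      unfolding card_halves_even[OF assms] by (intro prod.cong) (auto simp: t_def)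
    finally show "fps_nth (\<Prod>k=1..N. f k) n = fps_nth (\<Prod>k=1..N. inverse (1 - fps_X ^ k)
          ^ ((2 * l + card {a \<in> {1..2 * l}. [2 * a = t k] (mod (2 * l))}) div 2)) n" .
  qed
  then show ?thesis
    by (simp add: f_def t_def Sigma_C_def symmetric_diagrams_def)
qed

text \<open>The extra block now occurs for even row lengths, and
  \<open>(1 - fps_X ^ k) * (1 + fps_X ^ k)\<close> is the factor for the even length
  \<open>2 * k\<close>.\<close>

lemma prod_Sigma_D:
  assumes "1 \<le> l"
  shows "(\<lambda>k. 1 / ((1 - fps_X ^ Suc k) ^ (l + 1) * (1 + fps_X ^ Suc k)) :: 'a :: field fps) has_prod
    Abs_fps (\<lambda>n. of_nat (card (Sigma_D s (2 * l) (2 * n))))"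
proof -
  define f :: "nat \<Rightarrow> 'a fps" where "f k = 1 / ((1 - fps_X ^ k) ^ (l + 1) * (1 + fps_X ^ k))" for k
  have "(\<lambda>k. f (Suc k)) has_prod Abs_fps (\<lambda>n. of_nat (card (symmetric_diagrams s (2 * l) id (2 * n))))"
  proof (rule has_prod_card_symmetric_diagrams)
    show "0 < 2 * l"
      using assms by simp
    fix N n :: nat assume "n \<le> N"
    \<comment> \<open>\<open>?E\<close> cancels the factors of the truncated product whose exponent
      \<open>2 * k\<close> exceeds \<open>N\<close>, and leaves all coefficients up to
      \<open>N\<close> unchanged.\<close>
    let ?E = "\<Prod>k | k \<in> {1..N} \<and> N < 2 * k. 1 - fps_X ^ (2 * k) :: 'a fps"
    have "f k = inverse (1 - fps_X ^ k) ^ l * inverse (1 - fps_X ^ (2 * k))" if "0 < k" for k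
    proof -
      have "(1 - fps_X ^ k) ^ (l + 1) * (1 + fps_X ^ k) =
          (1 - fps_X ^ k) ^ l * (1 - fps_X ^ (2 * k) :: 'a fps)"
        unfolding one_plus_X_power_mult_one_minus[symmetric] by (simp add: mult_ac)
      then have "f k = 1 / ((1 - fps_X ^ k) ^ l * (1 - fps_X ^ (2 * k)))"
        by (simp only: f_def)
      with that show ?thesis
        by (simp add: fps_divide_unit fps_inverse_power fps_inverse_mult)
    qed
    then have "(\<Prod>k=1..N. f k) =
        (\<Prod>k=1..N. inverse (1 - fps_X ^ k) ^ l) * (\<Prod>k=1..N. inverse (1 - fps_X ^ (2 * k)))"
      by (simp flip: prod.distrib)
    also have "\<dots> = (\<Prod>k=1..N. inverse (1 - fps_X ^ k) ^ l) *
        (\<Prod>k | k \<in> {1..N} \<and> even k. inverse (1 - fps_X ^ k)) *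
        (\<Prod>k | k \<in> {1..N} \<and> N < 2 * k. inverse (1 - fps_X ^ (2 * k)))"
      by (simp only: prod_even_split[of "\<lambda>k. inverse (1 - fps_X ^ k)"] mult.assoc)
    finally have "(\<Prod>k=1..N. f k) * ?E = (\<Prod>k=1..N. inverse (1 - fps_X ^ k) ^ l) *
        (\<Prod>k | k \<in> {1..N} \<and> even k. inverse (1 - fps_X ^ k)) *
        ((\<Prod>k | k \<in> {1..N} \<and> N < 2 * k. inverse (1 - fps_X ^ (2 * k))) * ?E)"
      by (simp only: mult.assoc)
    also have "(\<Prod>k | k \<in> {1..N} \<and> N < 2 * k. inverse (1 - fps_X ^ (2 * k))) * ?E = 1"
      unfolding prod.distrib[symmetric]
      by (rule prod.neutral) (auto intro!: inverse_mult_eq_1)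
    also have "(\<Prod>k=1..N. inverse (1 - fps_X ^ k) ^ l) *
        (\<Prod>k | k \<in> {1..N} \<and> even k. inverse (1 - fps_X ^ k)) * 1 =
        (\<Prod>k=1..N. inverse (1 - fps_X ^ k :: 'a fps) ^ (l + (if even k then 1 else 0)))"
      by (simp only: prod_power_if_split mult_1_right)
    also have "\<dots> = (\<Prod>k=1..N. inverse (1 - fps_X ^ k)
          ^ ((2 * l + card {a \<in> {1..2 * l}. [2 * a = id k] (mod (2 * l))}) div 2))"
      unfolding card_halves_even[OF assms] by (intro prod.cong) auto
    finally have "(\<Prod>k=1..N. f k) * ?E = \<dots>" .
    moreover have "fps_nth ((\<Prod>k=1..N. f k) * ?E) n = fps_nth (\<Prod>k=1..N. f k) n"
      using \<open>n \<le> N\<close> by (intro fps_nth_mult_prod_one_minus_X_power) auto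
    ultimately show "fps_nth (\<Prod>k=1..N. f k) n = fps_nth (\<Prod>k=1..N. inverse (1 - fps_X ^ k)
          ^ ((2 * l + card {a \<in> {1..2 * l}. [2 * a = id k] (mod (2 * l))}) div 2)) n"
      by simp
  qed
  then show ?thesis
    by (simp add: f_def Sigma_D_def symmetric_diagrams_def)
qed

theorem lemma3p1:
  fixes s :: dsign and l :: nat
  shows
    "(\<lambda>k. 1 / (1 - fps_X ^ Suc k) ^ (l + 1)) has_prod
       (Abs_fps (\<lambda>n. of_nat (card (Sigma_A s (2 * l + 1) (2 * n)))) :: rat fps) \<and>
     (l \<ge> 1 \<longrightarrow>
       (\<lambda>k. (1 + fps_X ^ Suc k) / (1 - fps_X ^ Suc k) ^ l) has_prod
         (Abs_fps (\<lambda>n. of_nat (card (Sigma_C s (2 * l) (2 * n)))) :: rat fps) \<and>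
       (\<lambda>k. 1 / ((1 - fps_X ^ Suc k) ^ (l + 1) * (1 + fps_X ^ Suc k))) has_prod
         (Abs_fps (\<lambda>n. of_nat (card (Sigma_D s (2 * l) (2 * n)))) :: rat fps))"
  using prod_Sigma_A prod_Sigma_C prod_Sigma_D by blast

end
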